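(* Let $G=(D\cup I,E)$ be a split graph and $H(G)$ its corresponding hypergraph. The maximum number $M$ of completely independent spanning trees of $G$ satisfies $\chi_p^2(H(G))\leq M\leq \chi_p^2(H(G))+1$.
   Context: A split graph $G=(D\cup I,E)$ is a graph whose vertex set is partitioned into a clique $D$ and an independent set $I$; the paper assumes throughout that every vertex of $D$ is adjacent to at least one vertex of $I$. Its corresponding hypergraph is $H(G)=(D,\mathcal{E})$ with $\mathcal{E}=\{N_G(x) : x\in I\}$ (one hyperedge for each $x\in I$). A panchromatic $k$-coloring of a hypergraph is an assignment of colors from $\{1,\dots,k\}$ to its vertices such that every hyperedge contains at least one vertex of each of the $k$ colors; it is bipanchromatic if each of the $k$ colors is assigned to at least two vertices. The bipanchromatic number $\chi_p^2(H)$ is the maximum $k$ such that $H$ admits a bipanchromatic $k$-coloring. Spanning trees $T_1,\dots,T_m$ of a graph are completely independent spanning trees if for every pair of vertices $x,y$ the $(x,y)$-paths in $T_1,\dots,T_m$ are pairwise edge-disjoint and have no common internal vertex (for $m=1$, a single spanning tree). *)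

theory Defs
  imports "HOL-Library.Multiset"
begin

section \<open>Finite simple graphs\<close>

text \<open>
  A graph is given by its vertex set \<open>V\<close> and its set \<open>E\<close> of undirected edges; an edge is a
  two-element subset of \<open>V\<close>.
\<close>

definition simple_graph :: "'a set \<Rightarrow> 'a set set \<Rightarrow> bool" where
  "simple_graph V E \<longleftrightarrow> finite V \<and> (\<forall>e\<in>E. e \<subseteq> V \<and> card e = 2)"

definition neighbors :: "'a set set \<Rightarrow> 'a \<Rightarrow> 'a set" where
  "neighbors E x = {y. {x, y} \<in> E}"

fun path_edges :: "'a list \<Rightarrow> 'a set set" where
  "path_edges [] = {}"
| "path_edges [x] = {}"
| "path_edges (x # y # zs) = insert {x, y} (path_edges (y # zs))"

definition is_path :: "'a set \<Rightarrow> 'a set set \<Rightarrow> 'a \<Rightarrow> 'a list \<Rightarrow> 'a \<Rightarrow> bool" where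
  "is_path V E x p y \<longleftrightarrow>
     p \<noteq> [] \<and> hd p = x \<and> last p = y \<and> distinct p \<and> set p \<subseteq> V \<and> path_edges p \<subseteq> E"

definition internal_vertices :: "'a list \<Rightarrow> 'a set" where
  "internal_vertices p = set (butlast (tl p))"

definition connected_graph :: "'a set \<Rightarrow> 'a set set \<Rightarrow> bool" where
  "connected_graph V E \<longleftrightarrow> V \<noteq> {} \<and> (\<forall>x\<in>V. \<forall>y\<in>V. \<exists>p. is_path V E x p y)"

definition is_cycle :: "'a set \<Rightarrow> 'a set set \<Rightarrow> 'a list \<Rightarrow> bool" where
  "is_cycle V E p \<longleftrightarrow>
     length p \<ge> 3 \<and> distinct p \<and> set p \<subseteq> V \<and> path_edges p \<subseteq> E \<and> {last p, hd p} \<in> E"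

definition is_tree :: "'a set \<Rightarrow> 'a set set \<Rightarrow> bool" where
  "is_tree V E \<longleftrightarrow> simple_graph V E \<and> connected_graph V E \<and> (\<nexists>p. is_cycle V E p)"

text \<open>A spanning tree of \<open>(V, E)\<close> has vertex set \<open>V\<close>, so it is represented by its edge set.\<close>

definition spanning_tree :: "'a set \<Rightarrow> 'a set set \<Rightarrow> 'a set set \<Rightarrow> bool" where
  "spanning_tree V E T \<longleftrightarrow> T \<subseteq> E \<and> is_tree V T"


section \<open>Completely independent spanning trees\<close>

definition completely_independent_spanning_trees ::
    "'a set \<Rightarrow> 'a set set \<Rightarrow> 'a set set list \<Rightarrow> bool" where
  "completely_independent_spanning_trees V E Ts \<longleftrightarrow>
     (\<forall>T\<in>set Ts. spanning_tree V E T) \<and>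
     (\<forall>i<length Ts. \<forall>j<length Ts. i \<noteq> j \<longrightarrow>
        (\<forall>x\<in>V. \<forall>y\<in>V. x \<noteq> y \<longrightarrow>
           (\<forall>p q. is_path V (Ts ! i) x p y \<longrightarrow> is_path V (Ts ! j) x q y \<longrightarrow>
              path_edges p \<inter> path_edges q = {} \<and>
              internal_vertices p \<inter> internal_vertices q = {})))"

text \<open>
  The empty family is allowed, so the maximum is \<open>0\<close> exactly when there is no spanning tree,
  i.e. when the graph is disconnected. The set of which the maximum is taken is finite as soon
  as the graph has two vertices (on a single vertex, arbitrarily many copies of the trivial
  tree are completely independent); see \<open>finite_cist_lengths\<close> below.
\<close>

definition max_cist :: "'a set \<Rightarrow> 'a set set \<Rightarrow> nat" where
  "max_cist V E = Max {length Ts |Ts. completely_independent_spanning_trees V E Ts}"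

lemma path_edges_nonempty:
  assumes "is_path V E x p y" "x \<noteq> y"
  shows "path_edges p \<noteq> {}"
proof (cases p rule: path_edges.cases)
  case 1
  then show ?thesis using assms(1) by (simp add: is_path_def)
next
  case (2 z)
  then show ?thesis using assms by (auto simp: is_path_def)
next
  case (3 u v zs)
  then show ?thesis by simp
qed

lemma cist_length_le:
  assumes G: "simple_graph V E" and V: "x \<in> V" "y \<in> V" "x \<noteq> y"
    and Ts: "completely_independent_spanning_trees V E Ts"
  shows "length Ts \<le> card E"
proof -
  have tree: "spanning_tree V E (Ts ! i)" if "i < length Ts" for i
    using Ts that by (auto simp: completely_independent_spanning_trees_def)
  have "\<exists>p. is_path V (Ts ! i) x p y" if i: "i < length Ts" for i
    using tree[OF i] V unfolding spanning_tree_def is_tree_def connected_graph_def by blast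
  then obtain p where p: "is_path V (Ts ! i) x (p i) y" if "i < length Ts" for i
    by metis
  define e where "e i = (SOME f. f \<in> path_edges (p i))" for i
  have e: "e i \<in> path_edges (p i)" if i: "i < length Ts" for i
    using path_edges_nonempty[OF p[OF i] V(3)] unfolding e_def by (simp add: some_in_eq)
  have "inj_on e {..<length Ts}"
  proof (rule inj_onI)
    fix i j assume ij: "i \<in> {..<length Ts}" "j \<in> {..<length Ts}" "e i = e j"
    show "i = j"
    proof (rule ccontr)
      assume "i \<noteq> j"
      moreover have "is_path V (Ts ! i) x (p i) y" "is_path V (Ts ! j) x (p j) y"
        using p ij by simp_all
      ultimately have "path_edges (p i) \<inter> path_edges (p j) = {}"
        using Ts V ij by (simp add: completely_independent_spanning_trees_def)
      then show False
        using e[of i] e[of j] ij by auto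
    qed
  qed
  moreover have "e ` {..<length Ts} \<subseteq> E"
  proof
    fix f assume "f \<in> e ` {..<length Ts}"
    then obtain i where i: "i < length Ts" "f = e i" by blast
    have "path_edges (p i) \<subseteq> Ts ! i" "Ts ! i \<subseteq> E"
      using p[OF i(1)] tree[OF i(1)] by (simp_all add: is_path_def spanning_tree_def)
    then show "f \<in> E" using e[OF i(1)] i(2) by blast
  qed
  moreover have "finite E"
  proof (rule finite_subset)
    show "E \<subseteq> Pow V" "finite (Pow V)" using G by (auto simp: simple_graph_def)
  qed
  ultimately show ?thesis
    using card_inj_on_le[of e "{..<length Ts}" E] by simp
qed

lemma finite_cist_lengths:
  assumes "simple_graph V E" "x \<in> V" "y \<in> V" "x \<noteq> y"
  shows "finite {length Ts |Ts. completely_independent_spanning_trees V E Ts}"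
proof (rule finite_subset)
  show "{length Ts |Ts. completely_independent_spanning_trees V E Ts} \<subseteq> {..card E}"
    using cist_length_le[OF assms] by blast
qed simp


section \<open>Hypergraphs and bipanchromatic colorings\<close>

text \<open>A hypergraph is a vertex set together with a multiset of hyperedges.\<close>

type_synonym 'a hypergraph = "'a set \<times> 'a set multiset"

definition panchromatic_coloring :: "'a hypergraph \<Rightarrow> nat \<Rightarrow> ('a \<Rightarrow> nat) \<Rightarrow> bool" where
  "panchromatic_coloring H k c \<longleftrightarrow>
     (\<forall>v\<in>fst H. c v \<in> {1..k}) \<and> (\<forall>e. e \<in># snd H \<longrightarrow> (\<forall>i\<in>{1..k}. \<exists>v\<in>e. c v = i))"

definition bipanchromatic_coloring :: "'a hypergraph \<Rightarrow> nat \<Rightarrow> ('a \<Rightarrow> nat) \<Rightarrow> bool" where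
  "bipanchromatic_coloring H k c \<longleftrightarrow>
     panchromatic_coloring H k c \<and> (\<forall>i\<in>{1..k}. card {v \<in> fst H. c v = i} \<ge> 2)"

text \<open>
  The number is \<open>0\<close> if there is no bipanchromatic coloring at all, e.g. if there is
  only one vertex or some hyperedge is empty.
\<close>

definition bipanchromatic_number :: "'a hypergraph \<Rightarrow> nat" where
  "bipanchromatic_number H = Max (insert 0 {k. \<exists>c. bipanchromatic_coloring H k c})"

lemma finite_bipanchromatic:
  assumes "finite (fst H)"
  shows "finite {k. \<exists>c. bipanchromatic_coloring H k c}"
proof -
  have "k \<le> card (fst H)" if "bipanchromatic_coloring H k c" for k c
  proof -
    have "i \<in> c ` fst H" if i: "i \<in> {1..k}" for i
    proof -
      have "card {v \<in> fst H. c v = i} \<noteq> 0"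
        using \<open>bipanchromatic_coloring H k c\<close> i by (force simp: bipanchromatic_coloring_def)
      then have "{v \<in> fst H. c v = i} \<noteq> {}"
        by (metis card.empty)
      then show ?thesis by blast
    qed
    then have "card {1..k} \<le> card (fst H)"
      using assms by (intro surj_card_le[of _ _ c]) auto
    then show ?thesis by simp
  qed
  then have "{k. \<exists>c. bipanchromatic_coloring H k c} \<subseteq> {..card (fst H)}"
    by blast
  then show ?thesis
    by (rule finite_subset) simp
qed


section \<open>Split graphs\<close>

text \<open>Being the classes of a partition, \<open>D\<close> and \<open>I\<close> are nonempty.\<close>

definition split_graph :: "'a set \<Rightarrow> 'a set \<Rightarrow> 'a set set \<Rightarrow> bool" where
  "split_graph D I E \<longleftrightarrow>
     simple_graph (D \<union> I) E \<and> D \<noteq> {} \<and> I \<noteq> {} \<and> D \<inter> I = {} \<and>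
     (\<forall>x\<in>D. \<forall>y\<in>D. x \<noteq> y \<longrightarrow> {x, y} \<in> E) \<and>
     (\<forall>x\<in>I. \<forall>y\<in>I. {x, y} \<notin> E)"

definition split_hypergraph :: "'a set \<Rightarrow> 'a set \<Rightarrow> 'a set set \<Rightarrow> 'a hypergraph" where
  "split_hypergraph D I E = (D, image_mset (neighbors E) (mset_set I))"

end

theory Submission
  imports Defs
begin

text \<open>
  Trees are completely independent iff they are edge-disjoint and no vertex has degree at least two
  in two of them. Given a bipanchromatic coloring, the color classes serve as the sets of inner
  vertices: a class is spanned by a star, every vertex of \<open>I\<close> hangs on a neighbor of the right color,
  and between two classes of size at least two there is a 4-cycle, which can be shared out between
  the two trees. Conversely, the inner vertices of the trees that lie in \<open>D\<close> form classes that meet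
  every hyperedge. Two of these classes cannot both be singletons \<open>{a}\<close> and \<open>{b}\<close>: one of the two
  trees does not contain the edge \<open>ab\<close>, so it joins, say, \<open>b\<close> to an inner vertex in \<open>I\<close>, but the edge
  from there to \<open>b\<close> already belongs to the other tree. Giving up one class leaves the
  desired coloring.
\<close>

section \<open>Paths and trees\<close>

lemma nth_path_edges:
  "Suc i < length p \<Longrightarrow> {p ! i, p ! Suc i} \<in> path_edges p"
proof (induction p arbitrary: i rule: path_edges.induct)
  case (3 x y zs)
  then show ?case by (cases i) auto
qed auto

lemma path_edges_snoc:
  "p \<noteq> [] \<Longrightarrow> path_edges (p @ [z]) = insert {last p, z} (path_edges p)"
  by (induction p rule: path_edges.induct) auto

lemma path_edges_append_subset:
  "path_edges xs \<subseteq> path_edges (xs @ ys)"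
proof (induction xs rule: path_edges.induct)
  case (3 x y zs)
  then show ?case by simp blast
qed simp_all

text \<open>Reachability is the reflexive transitive closure of this relation, so walks compose
  without removal of repeated vertices. Passing \<open>V - {v}\<close> as first argument deletes a
  vertex while \<open>T\<close> stays unchanged.\<close>

definition adj_rel :: "'a set \<Rightarrow> 'a set set \<Rightarrow> ('a \<times> 'a) set" where
  "adj_rel V T = {(x, y). x \<in> V \<and> y \<in> V \<and> {x, y} \<in> T}"

lemma sym_adj_rel: "sym (adj_rel V T)"
  by (auto simp: sym_def adj_rel_def insert_commute)

lemma path_imp_rtrancl:
  "is_path V T x p y \<Longrightarrow> (x, y) \<in> (adj_rel V T)\<^sup>*"
proof (induction p arbitrary: x rule: path_edges.induct)
  case (3 u v zs)
  have "is_path V T v (v # zs) y" and "x = u" and "(u, v) \<in> adj_rel V T"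
    using "3.prems" by (auto simp: is_path_def adj_rel_def)
  then show ?case using "3.IH"[of v] by (simp add: converse_rtrancl_into_rtrancl)
qed (auto simp: is_path_def)

lemma rtrancl_imp_path:
  assumes "(x, y) \<in> (adj_rel V T)\<^sup>*" "x \<in> V"
  shows "\<exists>p. is_path V T x p y"
  using assms(1)
proof induction
  case base
  have "is_path V T x [x] x" using assms(2) by (simp add: is_path_def)
  then show ?case ..
next
  case (step y z)
  then obtain p where p: "is_path V T x p y" by blast
  show ?case
  proof (cases "z \<in> set p")
    case True
    \<comment> \<open>If \<open>z\<close> already lies on the path, the path is cut off there, which
      keeps it free of repetitions.\<close>
    then obtain as bs where ab: "p = as @ z # bs" by (meson split_list)
    have "path_edges (as @ [z]) \<subseteq> path_edges p"
      using path_edges_append_subset[of "as @ [z]" bs] ab by simp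
    then have "is_path V T x (as @ [z]) z"
      using p ab by (cases as) (auto simp: is_path_def)
    then show ?thesis ..
  next
    case False
    then have "is_path V T x (p @ [z]) z"
      using p step.hyps(2) by (auto simp: is_path_def path_edges_snoc adj_rel_def)
    then show ?thesis ..
  qed
qed

text \<open>The vertices of degree at least two when \<open>T\<close> is the edge set of a simple
  graph; in a tree, the non-leaves.\<close>

definition inner_vertices :: "'a set set \<Rightarrow> 'a set" where
  "inner_vertices T = {v. \<exists>x y. x \<noteq> y \<and> {v, x} \<in> T \<and> {v, y} \<in> T}"

lemma internal_vertices_subset:
  assumes "is_path V T x p y"
  shows "internal_vertices p \<subseteq> inner_vertices T"
proof
  fix v assume "v \<in> internal_vertices p"
  then obtain i where "i < length (butlast (tl p))" "v = butlast (tl p) ! i"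
    by (metis internal_vertices_def in_set_conv_nth)
  then have i: "i < length p - 2" "v = p ! Suc i"
    by (simp_all add: nth_butlast nth_tl)
  have "{p ! i, p ! Suc i} \<in> T" "{p ! Suc i, p ! Suc (Suc i)} \<in> T"
    using nth_path_edges[of i p] nth_path_edges[of "Suc i" p] i assms
    by (auto simp: is_path_def)
  moreover have "p ! i \<noteq> p ! Suc (Suc i)"
    using i assms by (simp add: is_path_def nth_eq_iff_index_eq)
  ultimately show "v \<in> inner_vertices T"
    unfolding inner_vertices_def i(2) mem_Collect_eq by (metis insert_commute)
qed

lemma internal_verticesI:
  assumes "v \<in> set p" "v \<noteq> hd p" "v \<noteq> last p"
  shows "v \<in> internal_vertices p"
proof -
  have "v \<in> set (tl p)" using assms by (cases p) auto
  then show ?thesis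
    using assms by (cases "tl p" rule: rev_cases; cases p) (auto simp: internal_vertices_def)
qed

lemma cycle_neighbors:
  assumes c: "is_cycle V T p" and v: "v \<in> set p"
  shows "\<exists>x\<in>set p. \<exists>y\<in>set p. x \<noteq> y \<and> {v, x} \<in> T \<and> {v, y} \<in> T"
proof -
  obtain i where i: "i < length p" "v = p ! i" using v by (metis in_set_conv_nth)
  have len: "length p \<ge> 3" and dist: "distinct p" and ends: "{last p, hd p} \<in> T"
    using c by (auto simp: is_cycle_def)
  have ends': "{p ! (length p - 1), p ! 0} \<in> T"
    using ends len by (metis hd_conv_nth last_conv_nth list.size(3) not_numeral_le_zero)
  have adj: "{p ! j, p ! Suc j} \<in> T" if "Suc j < length p" for j
    using nth_path_edges[OF that] c by (auto simp: is_cycle_def)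
  \<comment> \<open>Cyclic predecessor and successor of position \<open>i\<close>; they differ
    because a cycle has at least three vertices.\<close>
  define l r where "l = (if i = 0 then length p - 1 else i - 1)"
    and "r = (if i = length p - 1 then 0 else Suc i)"
  have lr: "l < length p" "r < length p" "l \<noteq> r"
    using i len by (auto simp: l_def r_def split: if_splits)
  have "{v, p ! l} \<in> T"
    using adj[of "i - 1"] ends' i by (cases "i = 0") (auto simp: l_def insert_commute)
  moreover have "{v, p ! r} \<in> T"
    using adj[of i] ends' i by (cases "i = length p - 1") (auto simp: r_def)
  moreover have "p ! l \<noteq> p ! r" using lr dist by (simp add: nth_eq_iff_index_eq)
  ultimately show ?thesis using lr by (meson nth_mem)
qed

text \<open>Following \<open>par\<close> lowers \<open>h\<close> and can stop only at
  \<open>r\<close>, hence connectedness. On a cycle, a vertex of maximal height would have both of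
  its cycle neighbors equal to its parent.\<close>

lemma is_tree_parent:
  fixes h :: "'a \<Rightarrow> nat"
  assumes "finite V" "r \<in> V"
    and par: "\<And>v. v \<in> V - {r} \<Longrightarrow> par v \<in> V \<and> h (par v) < h v"
  shows "is_tree V {{v, par v} | v. v \<in> V - {r}}" (is "is_tree V ?T")
proof -
  define T where "T = ?T"
  have T_iff: "{x, y} \<in> T \<longleftrightarrow> x \<in> V - {r} \<and> y = par x \<or> y \<in> V - {r} \<and> x = par y" for x y
    unfolding T_def mem_Collect_eq by (metis doubleton_eq_iff)
  have "simple_graph V T"
    unfolding simple_graph_def
  proof (intro conjI ballI)
    fix e assume "e \<in> T"
    then obtain v where v: "v \<in> V - {r}" "e = {v, par v}" unfolding T_def by blast
    then have "v \<noteq> par v" using par[of v] by (metis less_irrefl)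
    then show "e \<subseteq> V" "card e = 2" using v(1) par[OF v(1)] unfolding v(2) by simp_all
  qed fact
  have root: "(v, r) \<in> (adj_rel V T)\<^sup>*" if "v \<in> V" for v
    using that
  proof (induction "h v" arbitrary: v rule: less_induct)
    case less
    show ?case
    proof (cases "v = r")
      case False
      then have v: "v \<in> V - {r}" using less.prems by simp
      then have "(v, par v) \<in> adj_rel V T"
        using par[OF v] by (simp add: adj_rel_def T_iff)
      then show ?thesis
        using less.hyps[of "par v"] par[OF v] by (meson converse_rtrancl_into_rtrancl)
    qed simp
  qed
  have "(x, y) \<in> (adj_rel V T)\<^sup>*" if "x \<in> V" "y \<in> V" for x y
    using root[OF that(1)] root[OF that(2)] sym_rtrancl[OF sym_adj_rel]
    by (meson rtrancl_trans symD)
  then have "connected_graph V T"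
    using assms(2) rtrancl_imp_path unfolding connected_graph_def by (metis empty_iff)
  have "\<nexists>p. is_cycle V T p"
  proof
    assume "\<exists>p. is_cycle V T p"
    then obtain p where p: "is_cycle V T p" ..
    then have "set p \<noteq> {}" by (auto simp: is_cycle_def)
    then have "Max (h ` set p) \<in> h ` set p" by (intro Max_in) auto
    then obtain v where v: "v \<in> set p" "h v = Max (h ` set p)" by auto
    obtain x y where xy: "x \<in> set p" "y \<in> set p" "x \<noteq> y" "{v, x} \<in> T" "{v, y} \<in> T"
      using cycle_neighbors[OF p v(1)] by blast
    have "w = par v" if "w \<in> set p" "{v, w} \<in> T" for w
    proof (rule ccontr)
      assume "w \<noteq> par v"
      then have "w \<in> V - {r}" "v = par w"
        using that(2) by (simp_all add: T_iff)
      then have "h v < h w" using par[of w] by simp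
      then show False using v(2) that(1) by (simp add: leD)
    qed
    then show False using xy by metis
  qed
  with \<open>simple_graph V T\<close> \<open>connected_graph V T\<close> show ?thesis
    by (simp add: is_tree_def T_def)
qed

text \<open>A path from \<open>y\<close> to \<open>z\<close> that avoids \<open>v\<close> would
  close up to a cycle through \<open>v\<close>.\<close>

lemma tree_neighbors_separated:
  assumes T: "is_tree V T" and yz: "y \<noteq> z" "{v, y} \<in> T" "{v, z} \<in> T"
  shows "(y, z) \<notin> (adj_rel (V - {v}) T)\<^sup>*"
proof
  assume "(y, z) \<in> (adj_rel (V - {v}) T)\<^sup>*"
  moreover have e: "e \<subseteq> V \<and> card e = 2" if "e \<in> T" for e
    using T that by (auto simp: is_tree_def simple_graph_def)
  have "y \<in> V - {v}" "v \<in> V" using e[OF yz(2)] by auto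
  ultimately obtain p where p: "is_path (V - {v}) T y p z"
    using rtrancl_imp_path[of y z "V - {v}" T] by blast
  have "length p \<ge> 2"
    using p yz(1) by (cases p rule: path_edges.cases) (auto simp: is_path_def)
  then have "is_cycle V T (p @ [v])"
    using p yz \<open>v \<in> V\<close> by (auto simp: is_path_def is_cycle_def path_edges_snoc insert_commute)
  then show False using T by (auto simp: is_tree_def)
qed

lemma path_through_separating:
  assumes p: "is_path V T x p y" and xy: "(x, y) \<notin> (adj_rel (V - {v}) T)\<^sup>*" "x \<noteq> v" "y \<noteq> v"
  shows "v \<in> internal_vertices p"
proof (rule internal_verticesI)
  show "v \<in> set p"
  proof (rule ccontr)
    assume "v \<notin> set p"
    then have "is_path (V - {v}) T x p y" using p by (auto simp: is_path_def)
    then show False using xy(1) path_imp_rtrancl by fast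
  qed
qed (use p xy in \<open>auto simp: is_path_def\<close>)

section \<open>Completely independent spanning trees\<close>

text \<open>The edges of a path lie in its tree, and its internal vertices are inner vertices of
  that tree.\<close>

lemma cistI:
  assumes "\<And>T. T \<in> set Ts \<Longrightarrow> spanning_tree V E T"
    and "\<And>i j. i < length Ts \<Longrightarrow> j < length Ts \<Longrightarrow> i \<noteq> j \<Longrightarrow>
      Ts ! i \<inter> Ts ! j = {} \<and> inner_vertices (Ts ! i) \<inter> inner_vertices (Ts ! j) = {}"
  shows "completely_independent_spanning_trees V E Ts"
  unfolding completely_independent_spanning_trees_def
proof (intro conjI ballI allI impI)
  fix i j x y p q
  assume ij: "i < length Ts" "j < length Ts" "i \<noteq> j"
    and pq: "is_path V (Ts ! i) x p y" "is_path V (Ts ! j) x q y"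
  show "path_edges p \<inter> path_edges q = {}"
    using assms(2)[OF ij] pq by (auto simp: is_path_def)
  show "internal_vertices p \<inter> internal_vertices q = {}"
    using assms(2)[OF ij] internal_vertices_subset[OF pq(1)] internal_vertices_subset[OF pq(2)]
    by blast
qed (use assms(1) in auto)

lemma cist_tree:
  assumes "completely_independent_spanning_trees V E Ts" "i < length Ts"
  shows "Ts ! i \<subseteq> E" "is_tree V (Ts ! i)"
  using assms by (auto simp: completely_independent_spanning_trees_def spanning_tree_def)

lemma cist_edge_vertices:
  assumes "completely_independent_spanning_trees V E Ts" "i < length Ts" "{x, y} \<in> Ts ! i"
  shows "x \<in> V" "y \<in> V" "x \<noteq> y"
proof -
  have "{x, y} \<subseteq> V \<and> card {x, y} = 2"
    using cist_tree(2)[OF assms(1,2)] assms(3) unfolding is_tree_def simple_graph_def by blast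
  then show "x \<in> V" "y \<in> V" "x \<noteq> y" by auto
qed

text \<open>A shared edge would be, in both trees, the one-edge path between its ends.\<close>

lemma cist_edge_disjoint:
  assumes Ts: "completely_independent_spanning_trees V E Ts"
    and ij: "i < length Ts" "j < length Ts" "i \<noteq> j" and e: "{x, y} \<in> Ts ! i"
  shows "{x, y} \<notin> Ts ! j"
proof
  assume "{x, y} \<in> Ts ! j"
  moreover note v = cist_edge_vertices[OF Ts ij(1) e]
  ultimately have "is_path V (Ts ! i) x [x, y] y" "is_path V (Ts ! j) x [x, y] y"
    using e by (auto simp: is_path_def)
  then have "path_edges [x, y] \<inter> path_edges [x, y] = {}"
    using Ts ij v unfolding completely_independent_spanning_trees_def by blast
  then show False by simp
qed

text \<open>Deleting \<open>v\<close> disconnects each of the two trees. A pair \<open>x\<close>,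
  \<open>y\<close> that is separated in both at once makes \<open>v\<close> internal to both paths
  from \<open>x\<close> to \<open>y\<close>.\<close>

lemma cist_inner_disjoint:
  assumes Ts: "completely_independent_spanning_trees V E Ts"
    and ij: "i < length Ts" "j < length Ts" "i \<noteq> j"
    and v: "v \<in> inner_vertices (Ts ! i)"
  shows "v \<notin> inner_vertices (Ts ! j)"
proof
  assume v': "v \<in> inner_vertices (Ts ! j)"
  define R where "R l = (adj_rel (V - {v}) (Ts ! l))\<^sup>*" for l
  have symR: "(y, x) \<in> R l" if "(x, y) \<in> R l" for l x y
    using that sym_rtrancl[OF sym_adj_rel] unfolding R_def by (meson symD)
  have transR: "(x, z) \<in> R l" if "(x, y) \<in> R l" "(y, z) \<in> R l" for l x y z
    using that unfolding R_def by simp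
  have sep: "\<exists>y z. y \<in> V - {v} \<and> z \<in> V - {v} \<and> (y, z) \<notin> R l"
    if l: "l < length Ts" and v: "v \<in> inner_vertices (Ts ! l)" for l
  proof -
    obtain y z where "y \<noteq> z" "{v, y} \<in> Ts ! l" "{v, z} \<in> Ts ! l"
      using v by (auto simp: inner_vertices_def)
    then show ?thesis
      using tree_neighbors_separated[OF cist_tree(2)[OF Ts l]]
        cist_edge_vertices[OF Ts l] unfolding R_def by blast
  qed
  txt \<open>Of two equivalence relations with at least two classes each, neither covers the
    complement of the other.\<close>
  have "\<exists>x y. x \<in> V - {v} \<and> y \<in> V - {v} \<and> (x, y) \<notin> R i \<and> (x, y) \<notin> R j"
  proof (rule ccontr)
    assume "\<not> ?thesis"
    then have *: "(x, y) \<in> R j" if "x \<in> V - {v}" "y \<in> V - {v}" "(x, y) \<notin> R i" for x y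
      using that by blast
    obtain a b where ab: "a \<in> V - {v}" "b \<in> V - {v}" "(a, b) \<notin> R i"
      using sep[OF ij(1) v] by blast
    obtain c d where cd: "c \<in> V - {v}" "d \<in> V - {v}" "(c, d) \<notin> R j"
      using sep[OF ij(2) v'] by blast
    \<comment> \<open>Every \<open>z\<close> lies outside the \<open>R i\<close>-class of
      \<open>a\<close> or that of \<open>b\<close>, so it is \<open>R j\<close>-related to
      \<open>a\<close> or to \<open>b\<close>, and these two are \<open>R j\<close>-related to each
      other. Thus \<open>R j\<close> would have a single class.\<close>
    have "(a, z) \<in> R j" if "z \<in> V - {v}" for z
      using *[OF ab(1) that] *[OF that ab(2)] *[OF ab] ab(3) symR transR by meson
    then show False using cd symR transR by meson
  qed
  then obtain x y where xy: "x \<in> V - {v}" "y \<in> V - {v}" "(x, y) \<notin> R i" "(x, y) \<notin> R j"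
    by blast
  have "\<exists>p. is_path V (Ts ! l) x p y" if "l < length Ts" for l
    using cist_tree(2)[OF Ts that] xy(1,2) unfolding is_tree_def connected_graph_def by blast
  then obtain p q where pq: "is_path V (Ts ! i) x p y" "is_path V (Ts ! j) x q y"
    using ij by meson
  have "v \<in> internal_vertices p" "v \<in> internal_vertices q"
    using path_through_separating pq xy unfolding R_def by fast+
  moreover have "x \<noteq> y" using xy(3) by (auto simp: R_def)
  ultimately show False
    using Ts ij pq xy(1,2) unfolding completely_independent_spanning_trees_def by blast
qed

text \<open>Some edge from \<open>u\<close> to a vertex \<open>w\<close> in tree \<open>j\<close> is
  missing from tree \<open>i\<close>. The path from \<open>u\<close> to \<open>w\<close> in tree
  \<open>i\<close> then has at least two edges, so its second vertex is inner. The vertex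
  \<open>u'\<close> guarantees that \<open>u\<close> has an edge in tree \<open>j\<close>.\<close>

lemma cist_inner_neighbor:
  assumes Ts: "completely_independent_spanning_trees V E Ts"
    and ij: "i < length Ts" "j < length Ts" "i \<noteq> j"
    and u: "u \<in> V" and u': "u' \<in> V" "u \<noteq> u'"
  shows "\<exists>w \<in> inner_vertices (Ts ! i). {u, w} \<in> Ts ! i"
proof -
  have path: "\<exists>p. is_path V (Ts ! l) x p y" if "l < length Ts" "x \<in> V" "y \<in> V" for l x y
    using cist_tree(2)[OF Ts that(1)] that unfolding is_tree_def connected_graph_def by blast
  obtain p where p: "is_path V (Ts ! j) u p u'" using path[OF ij(2) u u'(1)] ..
  then obtain w where w: "{u, w} \<in> Ts ! j"
    using u'(2) by (cases p rule: path_edges.cases) (auto simp: is_path_def)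
  note wV = cist_edge_vertices[OF Ts ij(2) w]
  have "{u, w} \<notin> Ts ! i" using cist_edge_disjoint[OF Ts ij(2,1) _ w] ij(3) by simp
  moreover obtain q where q: "is_path V (Ts ! i) u q w" using path[OF ij(1) u wV(2)] ..
  ultimately have "length q \<ge> 3"
    using wV(3) by (cases q rule: path_edges.cases; cases "tl (tl q)") (auto simp: is_path_def)
  then obtain y z zs where "q = u # y # z # zs"
    using q by (cases q; cases "tl q"; cases "tl (tl q)") (auto simp: is_path_def)
  then have "{u, y} \<in> Ts ! i" "{y, z} \<in> Ts ! i" "u \<noteq> z"
    using q by (auto simp: is_path_def)
  then show ?thesis unfolding inner_vertices_def mem_Collect_eq Bex_def by (metis insert_commute)
qed

section \<open>Split graphs\<close>

lemma split_graph_neighbor: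
  assumes "split_graph D I E" "x \<in> I" "{x, y} \<in> E"
  shows "y \<in> D"
  using assms by (auto simp: split_graph_def simple_graph_def)

lemma set_mset_split_hypergraph:
  assumes "split_graph D I E"
  shows "set_mset (snd (split_hypergraph D I E)) = neighbors E ` I"
  using assms by (simp add: split_hypergraph_def split_graph_def simple_graph_def)

section \<open>From a bipanchromatic coloring to independent trees\<close>

lemma cist_of_bipanchromatic:
  assumes G: "split_graph D I E"
    and col: "bipanchromatic_coloring (split_hypergraph D I E) k c"
  shows "\<exists>Ts. completely_independent_spanning_trees (D \<union> I) E Ts \<and> length Ts = k"
proof -
  have fin: "finite (D \<union> I)" and disj: "D \<inter> I = {}"
    and clique: "\<And>x y. x \<in> D \<Longrightarrow> y \<in> D \<Longrightarrow> x \<noteq> y \<Longrightarrow> {x, y} \<in> E"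
    using G by (auto simp: split_graph_def simple_graph_def)
  have "\<forall>i\<in>{1..k}. \<exists>p. fst p \<in> D \<and> snd p \<in> D \<and> fst p \<noteq> snd p \<and> c (fst p) = i \<and> c (snd p) = i"
  proof
    fix i assume i: "i \<in> {1..k}"
    have "2 \<le> card {v \<in> D. c v = i}"
      using col i by (simp add: bipanchromatic_coloring_def split_hypergraph_def)
    then obtain S where S: "S \<subseteq> {v \<in> D. c v = i}" "card S = 2"
      by (meson obtain_subset_with_card_n)
    then obtain x y where "S = {x, y}" "x \<noteq> y" by (meson card_2_iff)
    with S(1) show "\<exists>p. fst p \<in> D \<and> snd p \<in> D \<and> fst p \<noteq> snd p \<and> c (fst p) = i \<and> c (snd p) = i"
      by (intro exI[of _ "(x, y)"]) simp
  qed
  from bchoice[OF this] obtain p where p: "\<forall>i\<in>{1..k}. fst (p i) \<in> D \<and> snd (p i) \<in> D \<and>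
      fst (p i) \<noteq> snd (p i) \<and> c (fst (p i)) = i \<and> c (snd (p i)) = i" ..
  define a b where "a i = fst (p i)" and "b i = snd (p i)" for i
  have ab: "a i \<in> D \<and> b i \<in> D \<and> a i \<noteq> b i \<and> c (a i) = i \<and> c (b i) = i" if "i \<in> {1..k}" for i
    unfolding a_def b_def by (rule bspec[OF p that])
  define n where "n i x = (SOME y. {x, y} \<in> E \<and> c y = i)" for i x
  have n: "{x, n i x} \<in> E \<and> c (n i x) = i" if i: "i \<in> {1..k}" and x: "x \<in> I" for i x
  proof -
    have "neighbors E x \<in># snd (split_hypergraph D I E)"
      using set_mset_split_hypergraph[OF G] x by simp
    then obtain y where "y \<in> neighbors E x" "c y = i"
      using col i unfolding bipanchromatic_coloring_def panchromatic_coloring_def by blast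
    then have "\<exists>y. {x, y} \<in> E \<and> c y = i" by (auto simp: neighbors_def)
    then show ?thesis unfolding n_def by (rule someI_ex)
  qed
  txt \<open>Between the classes of colors \<open>i < j\<close>, tree \<open>i\<close> receives the edges \<open>a\<^sub>j a\<^sub>i\<close> and \<open>b\<^sub>j b\<^sub>i\<close> of the
    cycle \<open>a\<^sub>i a\<^sub>j b\<^sub>i b\<^sub>j\<close>, and tree \<open>j\<close> the other two.\<close>
  define par where "par i v = (if v \<in> I then n i v else if c v = i then a i
      else if v = (if i < c v then b (c v) else a (c v)) then b i else a i)" for i v
  \<comment> \<open>The root \<open>a i\<close> has height 0 and is the parent of the rest of color
    class \<open>i\<close> at height 1; all other vertices have height 2 and a parent in that
    class.\<close>
  define h where "h i v = (if v = a i then 0 else if v \<in> D \<and> c v = i then 1 else 2 :: nat)" for i v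
  define T where "T i = {{v, par i v} | v. v \<in> (D \<union> I) - {a i}}" for i
  have par: "par i v \<in> D \<and> c (par i v) = i" if "i \<in> {1..k}" "v \<in> D \<union> I" for i v
    using that ab[of i] n[of i v] split_graph_neighbor[OF G, of v "n i v"] by (auto simp: par_def)
  have par_self: "par i v = a i" if "v \<in> D" "c v = i" for i v
    using that disj unfolding par_def by auto
  have tree: "is_tree (D \<union> I) (T i)" if i: "i \<in> {1..k}" for i
    unfolding T_def
  proof (rule is_tree_parent[OF fin])
    show "a i \<in> D \<union> I" using ab[OF i] by simp
    fix v assume v: "v \<in> D \<union> I - {a i}"
    then show "par i v \<in> D \<union> I \<and> h i (par i v) < h i v"
      using par[OF i, of v] disj by (cases "v \<in> D \<and> c v = i") (auto simp: h_def par_self)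
  qed
  have span: "spanning_tree (D \<union> I) E (T i)" if i: "i \<in> {1..k}" for i
    unfolding spanning_tree_def
  proof
    show "T i \<subseteq> E"
    proof
      fix e assume "e \<in> T i"
      then obtain v where v: "v \<in> (D \<union> I) - {a i}" "e = {v, par i v}" unfolding T_def by blast
      show "e \<in> E"
      proof (cases "v \<in> I")
        case True
        then show ?thesis using v n[OF i] by (simp add: par_def)
      next
        case False
        then have "v \<noteq> par i v" using v par[OF i, of v] par_self[of v i] by auto
        then show ?thesis using False v par[OF i, of v] clique by auto
      qed
    qed
  qed (rule tree[OF i])
  have inner: "v \<in> D \<and> c v = i" if i: "i \<in> {1..k}" and v: "v \<in> inner_vertices (T i)" for i v
  proof -
    obtain x y where xy: "x \<noteq> y" "{v, x} \<in> T i" "{v, y} \<in> T i"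
      using v by (auto simp: inner_vertices_def)
    have edge: "z = par i v \<or> (\<exists>w\<in>D \<union> I. v = par i w)" if "{v, z} \<in> T i" for z
      using that unfolding T_def mem_Collect_eq by (metis DiffD1 doubleton_eq_iff)
    \<comment> \<open>At most one of the two edges leads to the parent of \<open>v\<close>, so the
      other one leads to a child, and every parent in tree \<open>i\<close> has color
      \<open>i\<close>.\<close>
    obtain w where "w \<in> D \<union> I" "v = par i w"
      using edge[OF xy(2)] edge[OF xy(3)] xy(1) by metis
    then show ?thesis using par[OF i] by metis
  qed
  have disjoint_less: "T i \<inter> T j = {}" if i: "i \<in> {1..k}" and j: "j \<in> {1..k}" and ij: "i < j"
    for i j
  proof (rule ccontr)
    assume "T i \<inter> T j \<noteq> {}"
    then obtain v w where vw: "v \<in> D \<union> I" "w \<in> D \<union> I" "{v, par i v} = {w, par j w}"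
      unfolding T_def by blast
    have v: "par i v \<in> D" "c (par i v) = i" and w: "par j w \<in> D" "c (par j w) = j"
      using par[OF i vw(1)] par[OF j vw(2)] by simp_all
    \<comment> \<open>The two parents on the common edge have colors \<open>i\<close> and
      \<open>j\<close>, so they are its two ends and each end is the parent of the other.\<close>
    then have "par i v \<noteq> par j w" using ij by (metis less_irrefl)
    then have eq: "par i v = w" "par j w = v" using vw(3) by (metis doubleton_eq_iff)+
    have "v \<notin> I" "c v = j" "w \<notin> I" "c w = i" using v w disj unfolding eq by blast+
    \<comment> \<open>If \<open>v = b j\<close>, then \<open>w = b i\<close> and hence
      \<open>v = a j\<close>; otherwise \<open>w = a i\<close> and hence \<open>v = b j\<close>.
      Both are impossible.\<close>
    then have "w = (if v = b j then b i else a i)" "v = (if w = a i then b j else a j)"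
      using eq ij unfolding par_def by simp_all
    then show False using ab[OF i] ab[OF j] by metis
  qed
  have disjoint: "T i \<inter> T j = {}" if "i \<in> {1..k}" "j \<in> {1..k}" "i \<noteq> j" for i j
    using disjoint_less[OF that(1,2)] disjoint_less[OF that(2,1)] that(3)
    by (metis Int_commute linorder_neqE_nat)
  \<comment> \<open>Colors start at 1, list positions at 0.\<close>
  let ?Ts = "map (\<lambda>i. T (Suc i)) [0..<k]"
  have "completely_independent_spanning_trees (D \<union> I) E ?Ts"
  proof (rule cistI)
    fix S assume "S \<in> set ?Ts"
    then show "spanning_tree (D \<union> I) E S" using span by auto
  next
    fix i j assume ij: "i < length ?Ts" "j < length ?Ts" "i \<noteq> j"
    then have l: "Suc i \<in> {1..k}" "Suc j \<in> {1..k}" "Suc i \<noteq> Suc j" by simp_all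
    have "inner_vertices (T (Suc i)) \<inter> inner_vertices (T (Suc j)) = {}"
      using inner[OF l(1)] inner[OF l(2)] l(3) by (metis disjoint_iff)
    then show "?Ts ! i \<inter> ?Ts ! j = {} \<and> inner_vertices (?Ts ! i) \<inter> inner_vertices (?Ts ! j) = {}"
      using disjoint[OF l] ij by simp
  qed
  then show ?thesis by (intro exI[of _ ?Ts]) simp
qed

section \<open>From independent trees to a bipanchromatic coloring\<close>

lemma bipanchromatic_of_cist:
  assumes G: "split_graph D I E"
    and Ts: "completely_independent_spanning_trees (D \<union> I) E Ts" and m: "length Ts \<ge> 2"
  shows "\<exists>c. bipanchromatic_coloring (split_hypergraph D I E) (length Ts - 1) c"
proof -
  have fin: "finite D" "finite I" and disj: "D \<inter> I = {}" and ne: "D \<noteq> {}" "I \<noteq> {}"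
    using G by (auto simp: split_graph_def simple_graph_def)
  define W where "W i = inner_vertices (Ts ! i) \<inter> D" for i
  have nbr: "\<exists>w \<in> inner_vertices (Ts ! i). {u, w} \<in> Ts ! i"
    if i: "i < length Ts" and u: "u \<in> D \<union> I" for i u
  proof -
    \<comment> \<open>Any second tree serves for the comparison; \<open>m\<close> provides
      one.\<close>
    define j :: nat where "j = (if i = 0 then 1 else 0)"
    have j: "j < length Ts" "i \<noteq> j" using m by (auto simp: j_def)
    obtain d x where dx: "d \<in> D" "x \<in> I" using ne by blast
    then have "d \<noteq> x" using disj by blast
    then obtain u' where "u' \<in> D \<union> I" "u \<noteq> u'" using dx by (cases "u = d") auto
    then show ?thesis using cist_inner_neighbor[OF Ts i j(1) j(2) u] by blast
  qed
  \<comment> \<open>Neighbors of a vertex of \<open>I\<close> lie in \<open>D\<close>, so its inner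
    neighbor belongs to \<open>W i\<close>. Hence \<open>W i\<close> meets every hyperedge.\<close>
  have nbrW: "\<exists>w \<in> W i. {x, w} \<in> Ts ! i" if i: "i < length Ts" and x: "x \<in> I" for i x
  proof -
    obtain w where w: "w \<in> inner_vertices (Ts ! i)" "{x, w} \<in> Ts ! i" using nbr[OF i] x by blast
    then have "w \<in> D" using split_graph_neighbor[OF G x] cist_tree(1)[OF Ts i] by blast
    then show ?thesis using w by (auto simp: W_def)
  qed
  have disjW: "v \<notin> W j" if "i < length Ts" "j < length Ts" "i \<noteq> j" "v \<in> W i" for i j v
    using cist_inner_disjoint[OF Ts that(1-3)] that(4) by (auto simp: W_def)
  have finW: "finite (W i)" for i using fin by (simp add: W_def)
  have single: "\<exists>a. W i = {a}" if i: "i < length Ts" and "card (W i) < 2" for i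
  proof -
    have "W i \<noteq> {}" using nbrW[OF i] ne by blast
    then have "card (W i) = 1" using that(2) finW[of i] by (simp add: less_2_cases_iff)
    then show ?thesis by (simp add: card_1_singleton_iff)
  qed
  have edge: "{a, b} \<in> Ts ! i"
    if ij: "i < length Ts" "j < length Ts" "i \<noteq> j" and W: "W i = {a}" "W j = {b}" for i j a b
  proof -
    have "b \<in> D" using W by (auto simp: W_def)
    then obtain w where w: "w \<in> inner_vertices (Ts ! i)" "{b, w} \<in> Ts ! i"
      using nbr[OF ij(1)] by blast
    \<comment> \<open>For \<open>w\<close> in \<open>I\<close>, the inner neighbor of
      \<open>w\<close> in tree \<open>j\<close> must be \<open>b\<close>, the sole element of
      \<open>W j\<close>, so both trees would contain the edge between \<open>w\<close> and
      \<open>b\<close>.\<close>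
    have "w \<notin> I"
    proof
      assume "w \<in> I"
      then have "{w, b} \<in> Ts ! j" using nbrW[OF ij(2), of w] W by simp
      then show False
        using cist_edge_disjoint[OF Ts ij w(2)] by (simp add: insert_commute)
    qed
    then have "w \<in> W i" using w cist_edge_vertices[OF Ts ij(1) w(2)] by (auto simp: W_def)
    then show ?thesis using W w by (simp add: insert_commute)
  qed
  have two: "card (W i) \<ge> 2 \<or> card (W j) \<ge> 2" if ij: "i < length Ts" "j < length Ts" "i \<noteq> j" for i j
  proof (rule ccontr)
    assume "\<not> ?thesis"
    then obtain a b where W: "W i = {a}" "W j = {b}"
      using single[OF ij(1)] single[OF ij(2)] by force
    have "{a, b} \<in> Ts ! i" "{b, a} \<in> Ts ! j"
      using edge[OF ij W] edge[OF ij(2,1) _ W(2,1)] ij(3) by auto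
    then show False using cist_edge_disjoint[OF Ts ij] by (simp add: insert_commute)
  qed
  \<comment> \<open>At most one class is small, and \<open>s\<close> is its index; if none is small,
    any \<open>s\<close> works, even one out of range.\<close>
  have "\<exists>s. \<forall>i<length Ts. i \<noteq> s \<longrightarrow> card (W i) \<ge> 2"
    using two by blast
  then obtain s where s: "\<And>i. i < length Ts \<Longrightarrow> i \<noteq> s \<Longrightarrow> card (W i) \<ge> 2"
    by blast
  define k where "k = length Ts - 1"
  \<comment> \<open>Matches colors with tree indices while skipping \<open>s\<close>: colors up to
    \<open>s\<close> are shifted down by one because tree indices start at 0, later ones
    stay.\<close>
  define idx where "idx l = (if l \<le> s then l - 1 else l)" for l
  have idx: "idx l < length Ts" "idx l \<noteq> s" if "l \<in> {1..k}" for l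
    using that m by (auto simp: idx_def k_def)
  have idx_inj: "l = l'" if "l \<in> {1..k}" "l' \<in> {1..k}" "idx l = idx l'" for l l'
    using that by (auto simp: idx_def split: if_splits)
  \<comment> \<open>The choice of \<open>l\<close> is unique since the classes are disjoint and
    \<open>idx\<close> is injective. Vertices in no used class get color 1, which exists because
    \<open>k\<close> is at least 1; enlarging a class does no harm.\<close>
  define c where "c v = (if \<exists>l\<in>{1..k}. v \<in> W (idx l) then SOME l. l \<in> {1..k} \<and> v \<in> W (idx l) else 1)"
    for v
  have c_eq: "c v = l" if l: "l \<in> {1..k}" and v: "v \<in> W (idx l)" for v l
  proof -
    have "l' = l" if "l' \<in> {1..k} \<and> v \<in> W (idx l')" for l'
      using that l v disjW idx(1) idx_inj by metis
    then have "(SOME l. l \<in> {1..k} \<and> v \<in> W (idx l)) = l" using l v by (intro some_equality) auto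
    then show ?thesis unfolding c_def using l v by auto
  qed
  have c_range: "c v \<in> {1..k}" for v
  proof (cases "\<exists>l\<in>{1..k}. v \<in> W (idx l)")
    case True
    then show ?thesis using c_eq by blast
  next
    case False
    then have "c v = 1" by (auto simp: c_def)
    then show ?thesis using m by (simp add: k_def)
  qed
  have "bipanchromatic_coloring (split_hypergraph D I E) k c"
    unfolding bipanchromatic_coloring_def panchromatic_coloring_def
  proof (intro conjI ballI allI impI)
    fix e l assume "e \<in># snd (split_hypergraph D I E)" and l: "l \<in> {1..k}"
    then obtain x where x: "x \<in> I" "e = neighbors E x"
      using set_mset_split_hypergraph[OF G] by auto
    obtain w where w: "w \<in> W (idx l)" "{x, w} \<in> Ts ! idx l" using nbrW[OF idx(1)[OF l] x(1)] by blast
    then have "w \<in> e" using cist_tree(1)[OF Ts idx(1)[OF l]] x by (auto simp: neighbors_def)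
    then show "\<exists>v\<in>e. c v = l" using c_eq[OF l w(1)] by blast
  next
    fix l assume l: "l \<in> {1..k}"
    have "W (idx l) \<subseteq> {v \<in> fst (split_hypergraph D I E). c v = l}"
      using c_eq[OF l] by (auto simp: split_hypergraph_def W_def)
    then have "card (W (idx l)) \<le> card {v \<in> fst (split_hypergraph D I E). c v = l}"
      using fin by (intro card_mono) (auto simp: split_hypergraph_def)
    then show "2 \<le> card {v \<in> fst (split_hypergraph D I E). c v = l}"
      using s[OF idx[OF l]] by linarith
  qed (rule c_range)
  then show ?thesis unfolding k_def by blast
qed

section \<open>The two bounds on the maximum number of trees\<close>

theorem theorem8:
  fixes D I :: "'a set" and E :: "'a set set"
  assumes "split_graph D I E"
    and "\<forall>d\<in>D. \<exists>x\<in>I. {d, x} \<in> E"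
  shows "bipanchromatic_number (split_hypergraph D I E) \<le> max_cist (D \<union> I) E \<and>
         max_cist (D \<union> I) E \<le> bipanchromatic_number (split_hypergraph D I E) + 1"
proof -
  let ?H = "split_hypergraph D I E"
  let ?L = "{length Ts |Ts. completely_independent_spanning_trees (D \<union> I) E Ts}"
  let ?K = "{k. \<exists>c. bipanchromatic_coloring ?H k c}"
  \<comment> \<open>Two distinct vertices bound the possible numbers of trees, so that
    \<open>Max\<close> is taken over a finite set.\<close>
  obtain d x where dx: "d \<in> D" "x \<in> I" "d \<noteq> x" and G: "simple_graph (D \<union> I) E"
    using assms(1) unfolding split_graph_def by blast
  have finL: "finite ?L" using finite_cist_lengths[OF G, of d x] dx by simp
  have finK: "finite ?K"
    using G by (intro finite_bipanchromatic) (simp add: split_hypergraph_def simple_graph_def)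
  have "completely_independent_spanning_trees (D \<union> I) E []"
    by (simp add: completely_independent_spanning_trees_def)
  then have neL: "?L \<noteq> {}" by blast
  have "k \<le> max_cist (D \<union> I) E" if "k \<in> insert 0 ?K" for k
  proof (cases "k = 0")
    case False
    then have "k \<in> ?L" using that cist_of_bipanchromatic[OF assms(1)] by force
    then show ?thesis unfolding max_cist_def using finL by (rule Max_ge[rotated])
  qed simp
  then have "bipanchromatic_number ?H \<le> max_cist (D \<union> I) E"
    unfolding bipanchromatic_number_def using finK by (subst Max_le_iff) auto
  moreover have "length Ts \<le> bipanchromatic_number ?H + 1"
    if Ts: "completely_independent_spanning_trees (D \<union> I) E Ts" for Ts
  proof (cases "length Ts \<ge> 2")
    case True
    then have "length Ts - 1 \<in> insert 0 ?K" using bipanchromatic_of_cist[OF assms(1) Ts] by simp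
    then have "length Ts - 1 \<le> bipanchromatic_number ?H"
      unfolding bipanchromatic_number_def using finK by (intro Max_ge) auto
    then show ?thesis by simp
  \<comment> \<open>With at most one tree the bound holds trivially.\<close>
  qed simp
  then have "max_cist (D \<union> I) E \<le> bipanchromatic_number ?H + 1"
    unfolding max_cist_def using finL neL by (subst Max_le_iff) auto
  ultimately show ?thesis ..
qed

end
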